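(* Consider a sequence of multiple testing problems indexed by the number of tests $m\to\infty$, with parameters $p=p_m$, $\tau^2=\tau_m^2$, $\sigma^2=\sigma_m^2$, $\delta_0=\delta_{0m}$, $\delta_A=\delta_{Am}$ such that, with $u=\tau^2/\sigma^2$, $f=(1-p)/p$, $\delta=\delta_0/\delta_A$ and $v=uf^2\delta^2$, as $m\to\infty$: $p\to 0$, $u\to\infty$, $v\to\infty$ and $\frac{\log v}{u}\to C\in(0,\infty)$. Assume that $$mp_m\to s\in(0,\infty]\qquad\text{and}\qquad\frac{\log(mp_m)}{\log m}\to0 .$$ Let $\alpha_m\in(0,1)$ with $\alpha_m\to\alpha_\infty\in[0,1)$ and suppose that, with $r_{\alpha_m}=\frac{\alpha_m}{1-\alpha_m}$ and $s_m$ defined by $\frac{\log(f\delta\sqrt u)}{\log(f/r_{\alpha_m})}=1+s_m$, one has $s_m\to0$ and $2s_m\log(f/r_{\alpha_m})-\log\log(f/r_{\alpha_m})\to-\infty$. Then the Bonferroni procedure at FWER level $\alpha_m$ is ABOS.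
   Context: Model. Given a number of tests $m\ge 1$ and parameters $p\in(0,1)$, $\sigma^2>0$ (known), $\tau^2>0$, let $(\nu_i,X_i)$, $i=1,\dots,m$, be i.i.d. with $P(\nu_i=1)=p=1-P(\nu_i=0)$, $X_i\mid\nu_i=0\sim N(0,\sigma^2)$ and $X_i\mid\nu_i=1\sim N(0,\sigma^2+\tau^2)$. Only the $X_i$ are observed. The null hypothesis $H_{0i}$ is the event $\nu_i=0$, the alternative $H_{Ai}$ is $\nu_i=1$. A type I error (rejecting a true $H_{0i}$) costs $\delta_0>0$, a type II error (accepting $H_{0i}$ when $H_{Ai}$ holds) costs $\delta_A>0$, and the total loss is the sum over the $m$ tests. The Bayes risk of a multiple testing rule is $R=\delta_0E(V)+\delta_AE(T)$, where $V$ is the number of false rejections and $T$ the number of false acceptances; for a rule applying one fixed threshold in all tests, $R=m((1-p)t_1\delta_0+p\,t_2\delta_A)$ with $t_1,t_2$ the probabilities of type I and type II errors in a single test. Bayes oracle: the rule minimizing $R$; it rejects $H_{0i}$ iff $X_i^2/\sigma^2\ge(1+\frac1u)\left(\log v+\log(1+\frac1u)\right)$, where $u=\tau^2/\sigma^2$, $f=(1-p)/p$, $\delta=\delta_0/\delta_A$, $v=uf^2\delta^2$. Its Bayes risk is denoted $R_{\mathrm{opt}}$. ABOS (asymptotically Bayes optimal under sparsity): a rule with risk $R$ is ABOS if $R/R_{\mathrm{opt}}\to1$ as $m\to\infty$. Bonferroni procedure at FWER (family wise error rate) level $\alpha$: rejects all $H_{0i}$ for which $|X_i|/\sigma$ exceeds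 $c_{\mathrm{Bon}}$, where $1-\Phi(c_{\mathrm{Bon}})=\frac{\alpha}{2m}$ and $\Phi$ is the standard normal cdf. *)

theory Defs
  imports "HOL-Probability.Probability"
begin

abbreviation normal_law :: "real \<Rightarrow> real measure" where
  "normal_law s2 \<equiv> density lborel (normal_density 0 (sqrt s2))"

text \<open>
  The proposition \<open>nu i \<omega>\<close> stands for the event that the indicator of the i-th test equals one,
  i.e. that the alternative holds. The tests are indexed by 1, ..., m.
\<close>

locale two_groups_model = prob_space M for M :: "'a measure" +
  fixes m :: nat and p sigma2 tau2 :: real
    and nu :: "nat \<Rightarrow> 'a \<Rightarrow> bool" and X :: "nat \<Rightarrow> 'a \<Rightarrow> real"
  assumes m_pos: "m \<ge> 1"
    and p_pos: "0 < p" and p_less_1: "p < 1"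
    and sigma2_pos: "0 < sigma2" and tau2_pos: "0 < tau2"
    and indep: "indep_vars (\<lambda>_. count_space UNIV \<Otimes>\<^sub>M borel) (\<lambda>i \<omega>. (nu i \<omega>, X i \<omega>)) {1..m}"
    and prob_alternative: "i \<in> {1..m} \<Longrightarrow> \<P>(\<omega> in M. nu i \<omega>) = p"
    and law_null: "i \<in> {1..m} \<Longrightarrow> A \<in> sets borel \<Longrightarrow>
      \<P>(\<omega> in M. X i \<omega> \<in> A \<bar> \<not> nu i \<omega>) = measure (normal_law sigma2) A"
    and law_alternative: "i \<in> {1..m} \<Longrightarrow> A \<in> sets borel \<Longrightarrow>
      \<P>(\<omega> in M. X i \<omega> \<in> A \<bar> nu i \<omega>) = measure (normal_law (sigma2 + tau2)) A"

text \<open>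
  A multiple testing rule maps the vector of observations and an index to the decision whether the
  null hypothesis with this index is rejected.
\<close>

type_synonym rule = "(nat \<Rightarrow> real) \<Rightarrow> nat \<Rightarrow> bool"

definition observed :: "nat \<Rightarrow> (nat \<Rightarrow> 'a \<Rightarrow> real) \<Rightarrow> 'a \<Rightarrow> nat \<Rightarrow> real" where
  "observed m X \<omega> = (\<lambda>i\<in>{1..m}. X i \<omega>)"

definition false_rejections ::
    "nat \<Rightarrow> (nat \<Rightarrow> 'a \<Rightarrow> bool) \<Rightarrow> (nat \<Rightarrow> 'a \<Rightarrow> real) \<Rightarrow> rule \<Rightarrow> 'a \<Rightarrow> nat" where
  "false_rejections m nu X D \<omega> = card {i \<in> {1..m}. \<not> nu i \<omega> \<and> D (observed m X \<omega>) i}"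

definition false_acceptances ::
    "nat \<Rightarrow> (nat \<Rightarrow> 'a \<Rightarrow> bool) \<Rightarrow> (nat \<Rightarrow> 'a \<Rightarrow> real) \<Rightarrow> rule \<Rightarrow> 'a \<Rightarrow> nat" where
  "false_acceptances m nu X D \<omega> = card {i \<in> {1..m}. nu i \<omega> \<and> \<not> D (observed m X \<omega>) i}"

definition bayes_risk ::
    "'a measure \<Rightarrow> nat \<Rightarrow> (nat \<Rightarrow> 'a \<Rightarrow> bool) \<Rightarrow> (nat \<Rightarrow> 'a \<Rightarrow> real) \<Rightarrow> real \<Rightarrow> real \<Rightarrow> rule \<Rightarrow> real"
  where
  "bayes_risk M m nu X delta0 deltaA D =
     delta0 * (\<integral>\<omega>. real (false_rejections m nu X D \<omega>) \<partial>M)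
     + deltaA * (\<integral>\<omega>. real (false_acceptances m nu X D \<omega>) \<partial>M)"

definition bayes_oracle :: "real \<Rightarrow> real \<Rightarrow> real \<Rightarrow> real \<Rightarrow> real \<Rightarrow> rule" where
  "bayes_oracle p sigma2 tau2 delta0 deltaA x i \<longleftrightarrow>
     (let u = tau2 / sigma2; f = (1 - p) / p; delta = delta0 / deltaA; v = u * f\<^sup>2 * delta\<^sup>2
      in (x i)\<^sup>2 / sigma2 \<ge> (1 + 1 / u) * (ln v + ln (1 + 1 / u)))"

definition c_Bon :: "nat \<Rightarrow> real \<Rightarrow> real" where
  "c_Bon m alpha = (THE c. 1 - cdf std_normal_distribution c = alpha / (2 * real m))"

definition bonferroni :: "nat \<Rightarrow> real \<Rightarrow> real \<Rightarrow> rule" where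
  "bonferroni m alpha sigma2 x i \<longleftrightarrow> \<bar>x i\<bar> / sqrt sigma2 > c_Bon m alpha"

text \<open>
  Asymptotic Bayes optimality under sparsity of a sequence of rules, one for each number of tests.
\<close>

definition ABOS ::
    "(nat \<Rightarrow> 'a measure) \<Rightarrow> (nat \<Rightarrow> nat \<Rightarrow> 'a \<Rightarrow> bool) \<Rightarrow> (nat \<Rightarrow> nat \<Rightarrow> 'a \<Rightarrow> real) \<Rightarrow>
     (nat \<Rightarrow> real) \<Rightarrow> (nat \<Rightarrow> real) \<Rightarrow> (nat \<Rightarrow> real) \<Rightarrow> (nat \<Rightarrow> real) \<Rightarrow> (nat \<Rightarrow> real) \<Rightarrow>
     (nat \<Rightarrow> rule) \<Rightarrow> bool" where
  "ABOS M nu X p sigma2 tau2 delta0 deltaA D \<longleftrightarrow>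
     (\<lambda>m. bayes_risk (M m) m (nu m) (X m) (delta0 m) (deltaA m) (D m)
        / bayes_risk (M m) m (nu m) (X m) (delta0 m) (deltaA m)
            (bayes_oracle (p m) (sigma2 m) (tau2 m) (delta0 m) (deltaA m)))
     \<longlonglongrightarrow> 1"


subsection \<open>The Bonferroni threshold is well defined\<close>

lemma c_Bon_ex1:
  assumes "m \<ge> 1" "0 < alpha" "alpha < 1"
  shows "\<exists>!c. 1 - cdf std_normal_distribution c = alpha / (2 * real m)"
proof -
  let ?N = std_normal_distribution
  interpret real_distribution ?N by (rule real_dist_normal_dist)
  have atom: "measure ?N {x} = 0" for x
  proof -
    have "emeasure ?N {x} = 0"
      by (subst emeasure_density) (auto intro!: nn_integral_null_set)
    then show ?thesis by (simp add: measure_def)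
  qed
  have cont: "continuous_on S (cdf ?N)" for S
    using isCont_cdf atom by (simp add: continuous_at_imp_continuous_on)
  have strict: "cdf ?N a < cdf ?N b" if "a < b" for a b
  proof -
    have "measure ?N {a<..b} \<noteq> 0"
    proof
      assume "measure ?N {a<..b} = 0"
      then have "emeasure ?N {a<..b} = 0" by (simp add: emeasure_eq_measure)
      then have "{a<..b} \<in> null_sets ?N" by (simp add: null_sets_def)
      then have "AE x in lborel. x \<in> {a<..b} \<longrightarrow> ennreal (std_normal_density x) = 0"
        by (subst (asm) null_sets_density_iff) auto
      moreover have "ennreal (std_normal_density x) \<noteq> 0" for x :: real
        using normal_density_pos[of 1 0 x] by (auto simp: ennreal_eq_0_iff not_le)
      ultimately have "AE x in lborel. x \<notin> {a<..b}" by auto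
      then have "emeasure lborel {a<..b} = 0"
        by (subst (asm) AE_iff_measurable[OF _ refl]) (auto simp: greaterThanAtMost_def greaterThan_def atMost_def Int_def)
      then show False using that by simp
    qed
    moreover have "measure ?N {a<..b} \<ge> 0" by simp
    ultimately show ?thesis using cdf_diff_eq[OF that] by linarith
  qed
  define y where "y = 1 - alpha / (2 * real m)"
  have "alpha < 2 * real m" using assms by simp
  then have y: "0 < y" "y < 1" using assms by (auto simp: y_def field_simps)
  obtain a where a: "cdf ?N a < y"
    using order_tendstoD(2)[OF cdf_lim_at_bot y(1)] eventually_at_bot_linorder by (metis order_refl)
  obtain b where b: "y < cdf ?N b"
    using order_tendstoD(1)[OF cdf_lim_at_top_prob y(2)] eventually_at_top_linorder by (metis order_refl)
  have "a \<le> b" using a b strict by (metis less_trans not_le less_asym)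
  then obtain c where "cdf ?N c = y"
    using IVT'[of "cdf ?N" a y b] a b cont by (metis less_imp_le)
  moreover have "c = d" if "cdf ?N c = cdf ?N d" for c d
    using strict that by (metis less_irrefl linorder_cases)
  ultimately show ?thesis unfolding y_def by (auto intro!: ex1I[of _ c] simp: algebra_simps) 
qed


subsection \<open>The Bayes oracle minimizes the Bayes risk\<close>

lemma bayes_oracle_iff_density:
  assumes "0 < p" "p < 1" "0 < sigma2" "0 < tau2" "0 < delta0" "0 < deltaA"
  shows "bayes_oracle p sigma2 tau2 delta0 deltaA x i \<longleftrightarrow>
    delta0 * (1 - p) * normal_density 0 (sqrt sigma2) (x i)
      \<le> deltaA * p * normal_density 0 (sqrt (sigma2 + tau2)) (x i)"
proof -
  define u where "u = tau2 / sigma2"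
  define g where "g = ((1 - p) / p) * (delta0 / deltaA)"
  define t where "t = (x i)\<^sup>2 / sigma2"
  have pos: "0 < u" "0 < g" using assms by (auto simp: u_def g_def)
  have tau: "tau2 = u * sigma2" using assms by (simp add: u_def)
  have v: "u * ((1 - p) / p)\<^sup>2 * (delta0 / deltaA)\<^sup>2 = u * g\<^sup>2"
    by (simp add: g_def power_mult_distrib power_divide)
  have u1: "1 + 1 / u = (1 + u) / u" using pos by (simp add: field_simps)
  have ln: "ln (u * g\<^sup>2) + ln (1 + 1 / u) = 2 * ln g + ln (1 + u)"
    using pos by (simp add: u1 ln_mult ln_div ln_realpow)
  have d0: "normal_density 0 (sqrt sigma2) (x i) = exp (- t / 2) / sqrt (2 * pi * sigma2)"
    using assms by (simp add: normal_density_def t_def)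
  have d1: "normal_density 0 (sqrt (sigma2 + tau2)) (x i)
      = exp (- t / (2 * (1 + u))) / sqrt (2 * pi * sigma2) / sqrt (1 + u)"
  proof -
    have "sigma2 + tau2 = sigma2 * (1 + u)" by (simp add: tau algebra_simps)
    moreover have "(x i)\<^sup>2 / (2 * (sigma2 * (1 + u))) = t / (2 * (1 + u))"
      by (simp add: t_def)
    ultimately show ?thesis
      using assms pos by (simp add: normal_density_def) (simp add: real_sqrt_mult)
  qed
  let ?K = "sqrt (2 * pi * sigma2)"
  have K: "?K > 0" "sqrt (1 + u) > 0" using assms pos by auto
  have "delta0 * (1 - p) * normal_density 0 (sqrt sigma2) (x i)
      \<le> deltaA * p * normal_density 0 (sqrt (sigma2 + tau2)) (x i)
    \<longleftrightarrow> g * sqrt (1 + u) * exp (- t / 2) \<le> exp (- t / (2 * (1 + u)))"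
  proof -
    have "delta0 * (1 - p) = g * (deltaA * p)" using assms by (simp add: g_def)
    then have "delta0 * (1 - p) * (exp (- t / 2) / ?K)
        = deltaA * p / (?K * sqrt (1 + u)) * (g * sqrt (1 + u) * exp (- t / 2))"
      using K by simp
    moreover have "deltaA * p * (exp (- t / (2 * (1 + u))) / ?K / sqrt (1 + u))
        = deltaA * p / (?K * sqrt (1 + u)) * exp (- t / (2 * (1 + u)))"
      by simp
    moreover have "deltaA * p / (?K * sqrt (1 + u)) > 0" using assms K by simp
    ultimately show ?thesis unfolding d0 d1 by (simp only: mult_le_cancel_left_pos)
  qed
  also have "\<dots> \<longleftrightarrow> ln (g * sqrt (1 + u) * exp (- t / 2)) \<le> ln (exp (- t / (2 * (1 + u))))"
    using pos by (subst ln_le_cancel_iff) auto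
  also have "\<dots> \<longleftrightarrow> ln g + ln (1 + u) / 2 - t / 2 \<le> - t / (2 * (1 + u))"
    using pos by (simp add: ln_mult ln_sqrt)
  also have "\<dots> \<longleftrightarrow> 2 * ln g + ln (1 + u) \<le> t - t / (1 + u)"
  proof -
    have "t / (2 * (1 + u)) = (t / (1 + u)) / 2" by simp
    moreover have "a + b / 2 - t / 2 \<le> - c \<longleftrightarrow> 2 * a + b \<le> t - d"
      if "c = d / 2" for a b c d :: real
      using that by auto
    ultimately show ?thesis unfolding minus_divide_left[symmetric] by blast
  qed
  also have "t - t / (1 + u) = t * (u / (1 + u))"
    using pos by (simp add: field_simps)
  also have "2 * ln g + ln (1 + u) \<le> t * (u / (1 + u))
      \<longleftrightarrow> (1 + u) / u * (2 * ln g + ln (1 + u)) \<le> t"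
    using pos by (simp add: field_simps)
  finally show ?thesis
    unfolding bayes_oracle_def Let_def u_def[symmetric] t_def[symmetric] v ln u1[symmetric]
    by simp
qed

context two_groups_model
begin

lemma measurable_pair_obs [measurable]:
  assumes "i \<in> {1..m}"
  shows "(\<lambda>\<omega>. (nu i \<omega>, X i \<omega>)) \<in> measurable M (count_space UNIV \<Otimes>\<^sub>M borel)"
  using indep assms by (auto simp: indep_vars_def)

lemma measurable_nu: "i \<in> {1..m} \<Longrightarrow> nu i \<in> measurable M (count_space UNIV)"
  using measurable_compose[OF measurable_pair_obs measurable_fst] by simp

lemma measurable_X: "i \<in> {1..m} \<Longrightarrow> X i \<in> borel_measurable M"
  using measurable_compose[OF measurable_pair_obs measurable_snd] by simp

lemma measurable_observed:
  "observed m X \<in> measurable M (PiM {1..m} (\<lambda>_. borel))"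
  unfolding observed_def by (intro measurable_restrict measurable_X)

lemma bayes_risk_eq_sum:
  assumes D: "\<And>i. i \<in> {1..m} \<Longrightarrow> (\<lambda>x. D x i) \<in> measurable (PiM {1..m} (\<lambda>_. borel)) (count_space UNIV)"
  shows "bayes_risk M m nu X delta0 deltaA D =
    (\<Sum>i\<in>{1..m}. delta0 * \<P>(\<omega> in M. \<not> nu i \<omega> \<and> D (observed m X \<omega>) i)
              + deltaA * \<P>(\<omega> in M. nu i \<omega> \<and> \<not> D (observed m X \<omega>) i))"
proof -
  have DX: "(\<lambda>\<omega>. D (observed m X \<omega>) i) \<in> measurable M (count_space UNIV)" if "i \<in> {1..m}" for i
    by (rule measurable_compose[OF measurable_observed D[OF that]])
  have *: "(\<integral>\<omega>. real (card {i \<in> {1..m}. P i \<omega>}) \<partial>M) = (\<Sum>i\<in>{1..m}. \<P>(\<omega> in M. P i \<omega>))"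
    if P: "\<And>i. i \<in> {1..m} \<Longrightarrow> P i \<in> measurable M (count_space UNIV)" for P
  proof -
    have S: "{\<omega> \<in> space M. P i \<omega>} \<in> sets M" if "i \<in> {1..m}" for i
      using P[OF that] by measurable
    have "(\<integral>\<omega>. real (card {i \<in> {1..m}. P i \<omega>}) \<partial>M)
        = (\<integral>\<omega>. (\<Sum>i\<in>{1..m}. indicator {\<omega> \<in> space M. P i \<omega>} \<omega>) \<partial>M)"
    proof (rule Bochner_Integration.integral_cong[OF refl])
      fix \<omega> assume w: "\<omega> \<in> space M"
      have "real (card {i \<in> {1..m}. P i \<omega>}) = (\<Sum>i\<in>{1..m}. if P i \<omega> then 1 else 0)"
        by (simp add: sum.If_cases Int_def)
      then show "real (card {i \<in> {1..m}. P i \<omega>}) = (\<Sum>i\<in>{1..m}. indicator {\<omega> \<in> space M. P i \<omega>} \<omega>)"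
        using w unfolding indicator_def by (simp only: mem_Collect_eq simp_thms of_bool_def)
    qed
    also have "\<dots> = (\<Sum>i\<in>{1..m}. \<P>(\<omega> in M. P i \<omega>))"
      using S by (subst Bochner_Integration.integral_sum) (auto intro!: sum.cong simp: less_top[symmetric])
    finally show ?thesis .
  qed
  show ?thesis
    unfolding bayes_risk_def false_rejections_def false_acceptances_def
    using DX measurable_nu
    by (subst (1 2) *) (auto simp: sum_distrib_left sum.distrib)
qed

lemma joint_null:
  assumes "i \<in> {1..m}" "A \<in> sets borel"
  shows "\<P>(\<omega> in M. \<not> nu i \<omega> \<and> X i \<omega> \<in> A) = (1 - p) * measure (normal_law sigma2) A"
proof -
  have m: "{\<omega> \<in> space M. nu i \<omega>} \<in> sets M" using measurable_nu[OF assms(1)] by measurable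
  have "\<P>(\<omega> in M. \<not> nu i \<omega>) = 1 - p"
    using prob_neg[OF m] prob_alternative[OF assms(1)] by simp
  then show ?thesis
    using law_null[OF assms] p_less_1
    by (simp add: cond_prob_def conj_commute nonzero_divide_eq_eq mult.commute)
qed

lemma joint_alternative:
  assumes "i \<in> {1..m}" "A \<in> sets borel"
  shows "\<P>(\<omega> in M. nu i \<omega> \<and> X i \<omega> \<in> A) = p * measure (normal_law (sigma2 + tau2)) A"
  using law_alternative[OF assms] prob_alternative[OF assms(1)] p_pos
  by (simp add: cond_prob_def field_simps conj_commute)

text \<open>
  Only the case of a fixed rejection region needs the likelihood ratio; for a rule using all
  observations, one conditions on the other tests.
\<close>

lemma single_test_optimal:
  assumes pos: "0 < delta0" "0 < deltaA" and A: "A \<in> sets borel"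
  defines "R \<equiv> {t. delta0 * (1 - p) * normal_density 0 (sqrt sigma2) t
                 \<le> deltaA * p * normal_density 0 (sqrt (sigma2 + tau2)) t}"
  shows "delta0 * (1 - p) * measure (normal_law sigma2) R
           + deltaA * p * measure (normal_law (sigma2 + tau2)) (- R)
       \<le> delta0 * (1 - p) * measure (normal_law sigma2) A
           + deltaA * p * measure (normal_law (sigma2 + tau2)) (- A)"
proof -
  let ?n0 = "normal_density 0 (sqrt sigma2)" and ?n1 = "normal_density 0 (sqrt (sigma2 + tau2))"
  have s: "0 < sqrt sigma2" "0 < sqrt (sigma2 + tau2)"
    using sigma2_pos tau2_pos by auto
  have R: "R \<in> sets borel" unfolding R_def by measurable
  have meas: "measure (density lborel (normal_density 0 b)) S
      = (\<integral>t. indicator S t * normal_density 0 b t \<partial>lborel)"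
    if "S \<in> sets borel" "0 < b" for S b
  proof -
    have "measure (density lborel (normal_density 0 b)) S
        = (\<integral>t. indicator S t \<partial>density lborel (normal_density 0 b))"
      using that by simp
    also have "\<dots> = (\<integral>t. normal_density 0 b t *\<^sub>R indicator S t \<partial>lborel)"
      using that by (subst integral_density) auto
    finally show ?thesis by (simp add: mult.commute)
  qed
  have int: "integrable lborel (\<lambda>t. indicator S t * normal_density 0 b t)"
    if "S \<in> sets borel" "0 < b" for S :: "real set" and b
    using integrable_mult_indicator[OF _ integrable_normal_density[OF that(2)], of S 0] that by simp
  have eq: "delta0 * (1 - p) * measure (normal_law sigma2) S
           + deltaA * p * measure (normal_law (sigma2 + tau2)) (- S)
     = (\<integral>t. delta0 * (1 - p) * (indicator S t * ?n0 t) + deltaA * p * (indicator (- S) t * ?n1 t) \<partial>lborel)"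
    and int2: "integrable lborel (\<lambda>t. delta0 * (1 - p) * (indicator S t * ?n0 t) + deltaA * p * (indicator (- S) t * ?n1 t))"
    if S: "S \<in> sets borel" for S
  proof -
    have S': "- S \<in> sets borel" using S by auto
    show "delta0 * (1 - p) * measure (normal_law sigma2) S
           + deltaA * p * measure (normal_law (sigma2 + tau2)) (- S)
     = (\<integral>t. delta0 * (1 - p) * (indicator S t * ?n0 t) + deltaA * p * (indicator (- S) t * ?n1 t) \<partial>lborel)"
      unfolding meas[OF S s(1)] meas[OF S' s(2)]
      using int[OF S s(1)] int[OF S' s(2)] by simp
    show "integrable lborel (\<lambda>t. delta0 * (1 - p) * (indicator S t * ?n0 t) + deltaA * p * (indicator (- S) t * ?n1 t))"
      using int[OF S s(1)] int[OF S' s(2)] by simp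
  qed
  show ?thesis
    unfolding eq[OF A] eq[OF R]
    by (rule integral_mono[OF int2[OF R] int2[OF A]]) (auto simp: R_def indicator_def)
qed

lemma test_risk_optimal:
  assumes pos: "0 < delta0" "0 < deltaA" and i: "i \<in> {1..m}"
    and D: "(\<lambda>x. D x i) \<in> measurable (PiM {1..m} (\<lambda>_. borel)) (count_space UNIV)"
  defines "R \<equiv> {t. delta0 * (1 - p) * normal_density 0 (sqrt sigma2) t
                 \<le> deltaA * p * normal_density 0 (sqrt (sigma2 + tau2)) t}"
  shows "delta0 * \<P>(\<omega> in M. \<not> nu i \<omega> \<and> X i \<omega> \<in> R) + deltaA * \<P>(\<omega> in M. nu i \<omega> \<and> \<not> X i \<omega> \<in> R)
    \<le> delta0 * \<P>(\<omega> in M. \<not> nu i \<omega> \<and> D (observed m X \<omega>) i)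
      + deltaA * \<P>(\<omega> in M. nu i \<omega> \<and> \<not> D (observed m X \<omega>) i)"
proof -
  define J where "J = {1..m} - {i}"
  define B where "B = (count_space UNIV \<Otimes>\<^sub>M borel :: (bool \<times> real) measure)"
  define S where "S = PiM {i} (\<lambda>_. B)"
  define T where "T = PiM J (\<lambda>_. B)"
  define Z where "Z = (\<lambda>\<omega>. \<lambda>j\<in>{i}. (nu j \<omega>, X j \<omega>))"
  define Y where "Y = (\<lambda>\<omega>. \<lambda>j\<in>J. (nu j \<omega>, X j \<omega>))"
  define obs where "obs = (\<lambda>(y :: nat \<Rightarrow> bool \<times> real) t. (\<lambda>j\<in>J. snd (y j))(i := t))"
  have ind: "indep_var S Z T Y"
    unfolding S_def T_def Z_def Y_def B_def
    by (rule indep_var_restrict[OF indep]) (use i in \<open>auto simp: J_def\<close>)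
  then have rvZ: "Z \<in> measurable M S" and rvY: "Y \<in> measurable M T"
    and prod: "distr M S Z \<Otimes>\<^sub>M distr M T Y = distr M (S \<Otimes>\<^sub>M T) (\<lambda>\<omega>. (Z \<omega>, Y \<omega>))"
    by (auto simp: indep_var_distribution_eq)
  interpret PZ: prob_space "distr M S Z" by (rule prob_space_distr) fact
  interpret PY: prob_space "distr M T Y" by (rule prob_space_distr) fact
  interpret PP: pair_prob_space "distr M S Z" "distr M T Y" ..

  have I: "{1..m} = insert i J" using i by (auto simp: J_def)
  have obs: "observed m X \<omega> = obs (Y \<omega>) (X i \<omega>)" for \<omega>
    using i by (auto simp: observed_def obs_def Y_def J_def fun_eq_iff)
  have Gm: "(\<lambda>w. D (obs (snd w) (snd (fst w i))) i) \<in> measurable (S \<Otimes>\<^sub>M T) (count_space UNIV)"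
  proof (rule measurable_compose[OF _ D])
    have "(\<lambda>w. \<lambda>j\<in>J. snd (snd w j)) \<in> measurable (S \<Otimes>\<^sub>M T) (PiM J (\<lambda>_. borel))"
      unfolding T_def B_def
      by (intro measurable_restrict measurable_compose[OF measurable_snd]
          measurable_compose[OF measurable_component_singleton]) auto
    moreover have "(\<lambda>w. snd (fst w i)) \<in> measurable (S \<Otimes>\<^sub>M T) borel"
      unfolding S_def B_def
      by (intro measurable_compose[OF measurable_fst]
          measurable_compose[OF measurable_component_singleton]) auto
    ultimately show "(\<lambda>w. obs (snd w) (snd (fst w i))) \<in> measurable (S \<Otimes>\<^sub>M T) (PiM {1..m} (\<lambda>_. borel))"
      unfolding I obs_def by (intro measurable_fun_upd[where J=J]) auto
  qed
  have fm: "(\<lambda>w. fst (fst w i)) \<in> measurable (S \<Otimes>\<^sub>M T) (count_space UNIV)"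
    unfolding S_def B_def
    by (intro measurable_compose[OF measurable_fst]
        measurable_compose[OF measurable_component_singleton]) auto
  define E0 where "E0 = {w \<in> space (S \<Otimes>\<^sub>M T). \<not> fst (fst w i) \<and> D (obs (snd w) (snd (fst w i))) i}"
  define E1 where "E1 = {w \<in> space (S \<Otimes>\<^sub>M T). fst (fst w i) \<and> \<not> D (obs (snd w) (snd (fst w i))) i}"
  have E: "E0 \<in> sets (S \<Otimes>\<^sub>M T)" "E1 \<in> sets (S \<Otimes>\<^sub>M T)"
    unfolding E0_def E1_def using Gm fm by measurable
  define A where "A = (\<lambda>y. {t. D (obs y t) i})"
  have A: "A y \<in> sets borel" if "y \<in> space T" for y
  proof -
    have "(\<lambda>t. D (obs y t) i) \<in> measurable borel (count_space UNIV)"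
    proof (rule measurable_compose[OF _ D])
      show "obs y \<in> measurable borel (PiM {1..m} (\<lambda>_. borel))"
        unfolding I obs_def by (intro measurable_fun_upd[where J=J]) (auto simp: space_PiM)
    qed
    then show ?thesis unfolding A_def by measurable
  qed
  have ZY: "(\<lambda>\<omega>. (Z \<omega>, Y \<omega>)) \<in> measurable M (S \<Otimes>\<^sub>M T)"
    using rvZ rvY by simp
  have spM: "Y \<omega> \<in> space T" if "\<omega> \<in> space M" for \<omega>
    using rvY that by (rule measurable_space)

  have slice: "\<P>(\<omega> in M. (Z \<omega>, Y \<omega>) \<in> F) = (\<integral>y. measure (distr M S Z) ((\<lambda>z. (z, y)) -` F) \<partial>distr M T Y)"
    and slint: "integrable (distr M T Y) (\<lambda>y. measure (distr M S Z) ((\<lambda>z. (z, y)) -` F))"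
    if F: "F \<in> sets (S \<Otimes>\<^sub>M T)" for F
  proof -
    have F': "F \<in> sets (distr M S Z \<Otimes>\<^sub>M distr M T Y)" using F by (simp cong: sets_pair_measure_cong)
    have m1: "(\<lambda>y. emeasure (distr M S Z) ((\<lambda>z. (z, y)) -` F)) \<in> borel_measurable (distr M T Y)"
      using PP.measurable_emeasure_Pair2[OF F'] .
    then have m2: "(\<lambda>y. measure (distr M S Z) ((\<lambda>z. (z, y)) -` F)) \<in> borel_measurable (distr M T Y)"
      unfolding measure_def by measurable
    then show int: "integrable (distr M T Y) (\<lambda>y. measure (distr M S Z) ((\<lambda>z. (z, y)) -` F))"
      by (intro PY.integrable_const_bound[where B=1]) auto
    have "emeasure (distr M (S \<Otimes>\<^sub>M T) (\<lambda>\<omega>. (Z \<omega>, Y \<omega>))) F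
       = (\<integral>\<^sup>+y. emeasure (distr M S Z) ((\<lambda>z. (z, y)) -` F) \<partial>distr M T Y)"
      unfolding prod[symmetric] by (rule PP.emeasure_pair_measure_alt2[OF F'])
    also have "\<dots> = ennreal (\<integral>y. measure (distr M S Z) ((\<lambda>z. (z, y)) -` F) \<partial>distr M T Y)"
      using int by (subst nn_integral_eq_integral[symmetric]) (auto simp: PZ.emeasure_eq_measure)
    finally have "measure (distr M (S \<Otimes>\<^sub>M T) (\<lambda>\<omega>. (Z \<omega>, Y \<omega>))) F
        = (\<integral>y. measure (distr M S Z) ((\<lambda>z. (z, y)) -` F) \<partial>distr M T Y)"
      by (simp add: measure_def)
    then show "\<P>(\<omega> in M. (Z \<omega>, Y \<omega>) \<in> F) = (\<integral>y. measure (distr M S Z) ((\<lambda>z. (z, y)) -` F) \<partial>distr M T Y)"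
      using ZY F by (simp add: measure_distr vimage_def Int_def conj_commute)
  qed

  have s0: "measure (distr M S Z) ((\<lambda>z. (z, y)) -` E0) = (1 - p) * measure (normal_law sigma2) (A y)"
    and s1: "measure (distr M S Z) ((\<lambda>z. (z, y)) -` E1) = p * measure (normal_law (sigma2 + tau2)) (- A y)"
    if y: "y \<in> space T" for y
  proof -
    have "(\<lambda>z. (z, y)) -` E0 = {z \<in> space S. \<not> fst (z i) \<and> snd (z i) \<in> A y}"
      "(\<lambda>z. (z, y)) -` E1 = {z \<in> space S. fst (z i) \<and> snd (z i) \<in> - A y}"
      using y by (auto simp: E0_def E1_def A_def space_pair_measure)
    moreover have "(\<lambda>z. (z, y)) -` E0 \<in> sets S" "(\<lambda>z. (z, y)) -` E1 \<in> sets S"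
      using E by (auto intro: sets_Pair2)
    moreover have "Z -` {z \<in> space S. \<not> fst (z i) \<and> snd (z i) \<in> A y} \<inter> space M
        = {\<omega> \<in> space M. \<not> nu i \<omega> \<and> X i \<omega> \<in> A y}"
      "Z -` {z \<in> space S. fst (z i) \<and> snd (z i) \<in> - A y} \<inter> space M
        = {\<omega> \<in> space M. nu i \<omega> \<and> X i \<omega> \<in> - A y}"
      using measurable_space[OF rvZ] by (auto simp: Z_def)
    moreover have "- A y \<in> sets borel" using A[OF y] by auto
    ultimately show "measure (distr M S Z) ((\<lambda>z. (z, y)) -` E0) = (1 - p) * measure (normal_law sigma2) (A y)"
      "measure (distr M S Z) ((\<lambda>z. (z, y)) -` E1) = p * measure (normal_law (sigma2 + tau2)) (- A y)"
      using rvZ joint_null[OF i A[OF y]] joint_alternative[OF i, of "- A y"]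
      by (simp_all add: measure_distr)
  qed

  let ?m0 = "\<lambda>y. measure (distr M S Z) ((\<lambda>z. (z, y)) -` E0)"
  let ?m1 = "\<lambda>y. measure (distr M S Z) ((\<lambda>z. (z, y)) -` E1)"
  have e0: "\<P>(\<omega> in M. \<not> nu i \<omega> \<and> D (observed m X \<omega>) i) = \<P>(\<omega> in M. (Z \<omega>, Y \<omega>) \<in> E0)"
    and e1: "\<P>(\<omega> in M. nu i \<omega> \<and> \<not> D (observed m X \<omega>) i) = \<P>(\<omega> in M. (Z \<omega>, Y \<omega>) \<in> E1)"
    using spM
    by (auto intro!: arg_cong[where f=prob] simp: E0_def E1_def obs space_pair_measure Z_def dest: measurable_space[OF rvZ])

  have R: "R \<in> sets borel" "- R \<in> sets borel" unfolding R_def by measurable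
  define K where "K = delta0 * ((1 - p) * measure (normal_law sigma2) R)
      + deltaA * (p * measure (normal_law (sigma2 + tau2)) (- R))"
  have "delta0 * \<P>(\<omega> in M. \<not> nu i \<omega> \<and> X i \<omega> \<in> R) + deltaA * \<P>(\<omega> in M. nu i \<omega> \<and> \<not> X i \<omega> \<in> R) = K"
    using joint_null[OF i R(1)] joint_alternative[OF i R(2)] by (simp add: K_def)
  also have "K = (\<integral>y. K \<partial>distr M T Y)"
    using PY.prob_space by simp
  also have "\<dots> \<le> (\<integral>y. delta0 * ?m0 y + deltaA * ?m1 y \<partial>distr M T Y)"
  proof (rule integral_mono)
    show "integrable (distr M T Y) (\<lambda>y. K)" by simp
    show "integrable (distr M T Y) (\<lambda>y. delta0 * ?m0 y + deltaA * ?m1 y)"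
      using slint[OF E(1)] slint[OF E(2)] by simp
    fix y assume "y \<in> space (distr M T Y)"
    then have y: "y \<in> space T" by simp
    show "K \<le> delta0 * ?m0 y + deltaA * ?m1 y"
      using single_test_optimal[OF pos A[OF y]]
      unfolding K_def R_def s0[OF y] s1[OF y] by (simp add: mult.assoc)
  qed
  also have "\<dots> = delta0 * \<P>(\<omega> in M. (Z \<omega>, Y \<omega>) \<in> E0) + deltaA * \<P>(\<omega> in M. (Z \<omega>, Y \<omega>) \<in> E1)"
    unfolding slice[OF E(1)] slice[OF E(2)] using slint[OF E(1)] slint[OF E(2)] by simp
  finally show ?thesis unfolding e0 e1 .
qed

theorem bayes_oracle_minimizes:
  assumes pos: "0 < delta0" "0 < deltaA"
    and D: "\<And>i. i \<in> {1..m} \<Longrightarrow> (\<lambda>x. D x i) \<in> measurable (PiM {1..m} (\<lambda>_. borel)) (count_space UNIV)"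
  shows "bayes_risk M m nu X delta0 deltaA (bayes_oracle p sigma2 tau2 delta0 deltaA)
       \<le> bayes_risk M m nu X delta0 deltaA D"
proof -
  note iff = bayes_oracle_iff_density[OF p_pos p_less_1 sigma2_pos tau2_pos pos]
  have O: "(\<lambda>x. bayes_oracle p sigma2 tau2 delta0 deltaA x i)
      \<in> measurable (PiM {1..m} (\<lambda>_. borel)) (count_space UNIV)" if "i \<in> {1..m}" for i
    unfolding iff using that by measurable
  note eqD = bayes_risk_eq_sum[of D delta0 deltaA, OF D]
  note eqO = bayes_risk_eq_sum[of "bayes_oracle p sigma2 tau2 delta0 deltaA" delta0 deltaA, OF O]
  show ?thesis
  proof (subst eqD, assumption, subst eqO, assumption, rule sum_mono)
    fix i assume i: "i \<in> {1..m}"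
    show "delta0 * \<P>(\<omega> in M. \<not> nu i \<omega> \<and> bayes_oracle p sigma2 tau2 delta0 deltaA (observed m X \<omega>) i)
        + deltaA * \<P>(\<omega> in M. nu i \<omega> \<and> \<not> bayes_oracle p sigma2 tau2 delta0 deltaA (observed m X \<omega>) i)
      \<le> delta0 * \<P>(\<omega> in M. \<not> nu i \<omega> \<and> D (observed m X \<omega>) i)
        + deltaA * \<P>(\<omega> in M. nu i \<omega> \<and> \<not> D (observed m X \<omega>) i)"
      using test_risk_optimal[where D = D and i = i, OF pos i D[OF i]] i by (simp add: iff observed_def)
  qed
qed

end

end

theory Submission
  imports Defs
begin

text \<open>
  Let \<open>\<Phi>\<close> be the standard normal distribution function. A rule rejecting when \<open>|X\<^sub>i| / \<sigma>\<close> exceeds a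
  fixed threshold \<open>c\<close> has Bayes risk \<open>m p \<delta>\<^sub>A\<close> times
  \<open>2 f \<delta> (1 - \<Phi>(c)) + (2 \<Phi>(c / sqrt (1 + u)) - 1)\<close>,
  the first term coming from the false rejections and the second from the false acceptances
  (\<open>bayes_risk_threshold\<close>). The Bayes oracle and the Bonferroni procedure are both of this form,
  the former once \<open>v > 1\<close>.
  For both, the first term tends to 0 and \<open>c / sqrt (1 + u)\<close> tends to \<open>sqrt C\<close>, so both normalised
  risks tend to \<open>2 \<Phi>(sqrt C) - 1\<close>, which is positive because \<open>C > 0\<close>. Hence the risk ratio tends to 1.

  For the oracle this follows from its explicit threshold and the bound
  \<open>1 - \<Phi>(c) \<le> exp (- c\<^sup>2 / 2)\<close> (\<open>oracle_threshold_asymp\<close>).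

  For Bonferroni, put \<open>L = ln (f / r)\<close>. The relation \<open>ln (f \<delta> sqrt u) = (1 + s) L\<close> gives
  \<open>ln v = 2 (1 + s) L\<close>, so \<open>L\<close> tends to infinity and \<open>L / u\<close> tends to \<open>C / 2\<close>. The type I error
  probability is exactly \<open>\<alpha> / m\<close>, so the first term is \<open>f \<delta> \<alpha> / m\<close>, which equals
  \<open>(1 - p) (1 - \<alpha>) / (m p) \<cdot> exp ((2 s L - ln L) / 2) \<cdot> sqrt (L / u)\<close>
  and tends to 0 because \<open>m p\<close> is bounded away from 0. For the threshold,
  \<open>ln (2 m / \<alpha>) = L + ln (m p) + O(1)\<close> and \<open>ln (m p)\<close> is negligible against \<open>L\<close>
  (\<open>ln_expected_alternatives_negligible\<close>), so \<open>- ln (1 - \<Phi>(c)) \<sim> L\<close>; Gaussian tail bounds turn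
  this into \<open>c\<^sup>2 \<sim> 2 L \<sim> C u\<close> (\<open>upper_quantile_asymp\<close>).
\<close>

section \<open>The standard normal distribution\<close>

text \<open>The standard normal distribution function.\<close>

abbreviation Phi :: "real \<Rightarrow> real" where
  "Phi \<equiv> cdf std_normal_distribution"

lemma std_normal_measure_singleton: "measure std_normal_distribution {x} = 0"
proof -
  have "emeasure std_normal_distribution {x} = 0"
    by (subst emeasure_density) (auto intro!: nn_integral_null_set)
  then show ?thesis by (simp add: measure_def)
qed

lemma isCont_Phi: "isCont Phi x"
proof -
  interpret real_distribution std_normal_distribution by (rule real_dist_normal_dist)
  show ?thesis using isCont_cdf std_normal_measure_singleton by simp
qed

lemma Phi_le_1: "Phi x \<le> 1"
proof -
  interpret real_distribution std_normal_distribution by (rule real_dist_normal_dist)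
  show ?thesis by (rule cdf_bounded_prob)
qed

lemma measure_normal_eq_integral:
  assumes "A \<in> sets borel" "0 < s"
  shows "measure (density lborel (normal_density 0 s)) A
    = (\<integral>t. indicator A t * normal_density 0 s t \<partial>lborel)"
proof -
  have "measure (density lborel (normal_density 0 s)) A
      = (\<integral>t. indicator A t \<partial>density lborel (normal_density 0 s))"
    using assms by simp
  also have "\<dots> = (\<integral>t. normal_density 0 s t *\<^sub>R indicator A t \<partial>lborel)"
    using assms by (subst integral_density) auto
  finally show ?thesis by (simp add: mult.commute)
qed

lemma measure_normal_scale:
  assumes a: "a \<noteq> 0" and A: "A \<in> sets borel"
  shows "measure (density lborel (normal_density 0 \<bar>a\<bar>)) A
    = measure std_normal_distribution {x. a * x \<in> A}"
proof -
  interpret real_distribution std_normal_distribution by (rule real_dist_normal_dist)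
  have "distributed std_normal_distribution lborel (\<lambda>x. x) std_normal_density"
    by (auto simp: distributed_def distr_id2)
  from normal_density_affine[OF this _ a, of 0]
  have "distributed std_normal_distribution lborel (\<lambda>x. a * x) (normal_density 0 \<bar>a\<bar>)"
    by simp
  then have "density lborel (normal_density 0 \<bar>a\<bar>) = distr std_normal_distribution lborel (\<lambda>x. a * x)"
    by (simp add: distributed_def)
  then show ?thesis
    using A by (simp add: measure_distr vimage_def)
qed

lemma Phi_minus: "Phi (- x) = 1 - Phi x"
proof -
  interpret real_distribution std_normal_distribution by (rule real_dist_normal_dist)
  have "Phi (- x) = measure std_normal_distribution {y. - 1 * y \<in> {..- x}}"
    unfolding cdf_def using measure_normal_scale[of "- 1" "{..- x}"] by simp
  also have "{y. - 1 * y \<in> {..- x}} = {x..}" by auto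
  also have "measure std_normal_distribution {x..} = measure std_normal_distribution (UNIV - {..<x})"
    by (rule arg_cong[where f = "measure std_normal_distribution"]) auto
  also have "\<dots> = 1 - measure std_normal_distribution {..<x}"
    using prob_compl[of "{..<x}"] by simp
  also have "measure std_normal_distribution {..<x} = Phi x"
  proof -
    have "Phi x = measure std_normal_distribution ({..<x} \<union> {x})"
      unfolding cdf_def by (rule arg_cong[where f = "measure std_normal_distribution"]) auto
    also have "\<dots> = measure std_normal_distribution {..<x}"
      by (subst finite_measure_Union) (auto simp: std_normal_measure_singleton)
    finally show ?thesis by simp
  qed
  finally show ?thesis .
qed

lemma Phi_0: "Phi 0 = 1 / 2"
  using Phi_minus[of 0] by simp

text \<open>
  The boundary of a two-sided rejection region is a null set, so strict and nonstrict thresholds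
  have the same rejection probability.
\<close>

lemma measure_normal_two_sided:
  assumes s: "0 < s" and c: "0 \<le> c" and B: "B \<in> sets borel"
    and inner: "\<And>x. c < \<bar>x\<bar> \<Longrightarrow> x \<in> B" and outer: "\<And>x. x \<in> B \<Longrightarrow> c \<le> \<bar>x\<bar>"
  shows "measure (density lborel (normal_density 0 s)) B = 2 * (1 - Phi (c / s))"
proof -
  interpret real_distribution std_normal_distribution by (rule real_dist_normal_dist)
  let ?N = std_normal_distribution
  define d where "d = c / s"
  have d: "0 \<le> d" using s c by (simp add: d_def)
  have le: "d \<le> \<bar>x\<bar> \<longleftrightarrow> c \<le> \<bar>s * x\<bar>" and less: "d < \<bar>x\<bar> \<longleftrightarrow> c < \<bar>s * x\<bar>" for x
    using s by (auto simp: d_def abs_mult field_simps)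
  define S where "S = {x. s * x \<in> B}"
  have S: "S \<in> sets borel" unfolding S_def using B by measurable
  have gt: "measure ?N {d<..} = 1 - Phi d"
    using prob_compl[of "{..d}"] by (simp add: cdf_def Compl_eq_Diff_UNIV[symmetric])
  have le_minus: "measure ?N {..- d} = 1 - Phi d"
    using Phi_minus[of d] by (simp add: cdf_def)
  have lt_minus: "measure ?N {..<- d} = 1 - Phi d"
  proof -
    have "measure ?N {..- d} = measure ?N ({..<- d} \<union> {- d})"
      by (rule arg_cong[where f = "measure ?N"]) auto
    also have "\<dots> = measure ?N {..<- d}"
      by (subst finite_measure_Union) (auto simp: std_normal_measure_singleton)
    finally show ?thesis using le_minus by simp
  qed
  have ge: "measure ?N {d..} = 1 - Phi d"
  proof -
    have "measure ?N {d..} = measure ?N ({d<..} \<union> {d})"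
      by (rule arg_cong[where f = "measure ?N"]) auto
    also have "\<dots> = measure ?N {d<..}"
      by (subst finite_measure_Union) (auto simp: std_normal_measure_singleton)
    finally show ?thesis using gt by simp
  qed
  have "measure ?N S \<le> measure ?N ({..- d} \<union> {d..})"
  proof (rule finite_measure_mono)
    show "S \<subseteq> {..- d} \<union> {d..}"
    proof
      fix x assume "x \<in> S"
      then have "d \<le> \<bar>x\<bar>" using outer[of "s * x"] by (simp add: S_def le)
      then show "x \<in> {..- d} \<union> {d..}" by auto
    qed
  qed auto
  also have "\<dots> \<le> measure ?N {..- d} + measure ?N {d..}"
    by (rule measure_Un_le) auto
  finally have upper: "measure ?N S \<le> 2 * (1 - Phi d)" using le_minus ge by simp
  have "2 * (1 - Phi d) = measure ?N ({..<- d} \<union> {d<..})"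
    using d gt lt_minus by (subst finite_measure_Union) auto
  also have "\<dots> \<le> measure ?N S"
  proof (rule finite_measure_mono)
    show "{..<- d} \<union> {d<..} \<subseteq> S"
    proof
      fix x assume "x \<in> {..<- d} \<union> {d<..}"
      then have "d < \<bar>x\<bar>" by auto
      then show "x \<in> S" using inner[of "s * x"] by (simp add: S_def less)
    qed
    show "S \<in> events" using S by simp
  qed
  finally have "measure ?N S = 2 * (1 - Phi d)" using upper by simp
  then show ?thesis
    using measure_normal_scale[of s B] s B by (simp add: S_def d_def)
qed

text \<open>
  Chernoff bound by exponential tilting: to the right of \<open>c\<close>, the standard normal density is at
  most \<open>exp (- c\<^sup>2 / 2)\<close> times the density with mean \<open>c\<close>.
\<close>

lemma Phi_upper_tail_le:
  assumes "0 \<le> c"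
  shows "1 - Phi c \<le> exp (- c\<^sup>2 / 2)"
proof -
  interpret real_distribution std_normal_distribution by (rule real_dist_normal_dist)
  have "1 - Phi c = measure std_normal_distribution {c<..}"
    using prob_compl[of "{..c}"] by (simp add: cdf_def Compl_eq_Diff_UNIV[symmetric])
  also have "\<dots> = (\<integral>t. indicator {c<..} t * std_normal_density t \<partial>lborel)"
    by (rule measure_normal_eq_integral) auto
  also have "\<dots> \<le> (\<integral>t. exp (- c\<^sup>2 / 2) * normal_density c 1 t \<partial>lborel)"
  proof (rule integral_mono)
    show "integrable lborel (\<lambda>t. indicator {c<..} t * std_normal_density t)"
      using integrable_mult_indicator[of "{c<..}" lborel std_normal_density] by simp
    show "integrable lborel (\<lambda>t. exp (- c\<^sup>2 / 2) * normal_density c 1 t)" by simp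
    fix t :: real
    have "std_normal_density t \<le> exp (- c\<^sup>2 / 2) * normal_density c 1 t" if "c < t"
    proof -
      have "c * c \<le> c * t" using that assms by (intro mult_left_mono) auto
      then have "- t\<^sup>2 / 2 \<le> - c\<^sup>2 / 2 + - (t - c)\<^sup>2 / 2"
        by (simp add: power2_eq_square field_simps)
      then have "exp (- t\<^sup>2 / 2) \<le> exp (- c\<^sup>2 / 2) * exp (- (t - c)\<^sup>2 / 2)"
        by (simp only: exp_add[symmetric] exp_le_cancel_iff)
      then show ?thesis by (simp add: normal_density_def divide_right_mono)
    qed
    then show "indicator {c<..} t * std_normal_density t \<le> exp (- c\<^sup>2 / 2) * normal_density c 1 t"
      by (auto simp: indicator_def)
  qed
  also have "\<dots> = exp (- c\<^sup>2 / 2)" by simp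
  finally show ?thesis .
qed

lemma Phi_increment_ge:
  assumes "0 \<le> a" "a \<le> b"
  shows "Phi b - Phi a \<ge> (b - a) * std_normal_density b"
proof (cases "a = b")
  case False
  then have ab: "a < b" using assms by simp
  interpret real_distribution std_normal_distribution by (rule real_dist_normal_dist)
  have "(b - a) * std_normal_density b = (\<integral>t. indicator {a<..b} t * std_normal_density b \<partial>lborel)"
    using ab by simp
  also have "\<dots> \<le> (\<integral>t. indicator {a<..b} t * std_normal_density t \<partial>lborel)"
  proof (rule integral_mono)
    show "integrable lborel (\<lambda>t. indicator {a<..b} t * std_normal_density t)"
      using integrable_mult_indicator[of "{a<..b}" lborel std_normal_density] by simp
    show "integrable lborel (\<lambda>t. indicator {a<..b} t * std_normal_density b)" using ab by simp
    fix t :: real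
    have "std_normal_density b \<le> std_normal_density t" if "a < t" "t \<le> b"
    proof -
      have "t\<^sup>2 \<le> b\<^sup>2" using that assms by (intro power_mono) auto
      then show ?thesis by (simp add: normal_density_def divide_right_mono)
    qed
    then show "indicator {a<..b} t * std_normal_density b \<le> indicator {a<..b} t * std_normal_density t"
      by (auto simp: indicator_def)
  qed
  also have "\<dots> = measure std_normal_distribution {a<..b}"
    by (rule measure_normal_eq_integral[symmetric]) auto
  also have "\<dots> = Phi b - Phi a" using cdf_diff_eq[OF ab] by simp
  finally show ?thesis by simp
qed simp

lemma Phi_upper_tail_ge:
  assumes "0 \<le> c"
  shows "1 - Phi c \<ge> std_normal_density (c + 1)"
  using Phi_increment_ge[of c "c + 1"] assms Phi_le_1[of "c + 1"] by simp

lemma Phi_gt_half: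
  assumes "0 < x"
  shows "1 / 2 < Phi x"
proof -
  have "0 < x * std_normal_density x" using assms by (simp add: normal_density_pos)
  then show ?thesis using Phi_increment_ge[of 0 x] assms Phi_0 by simp
qed

text \<open>
  The two tail bounds locate the upper \<open>q\<close>-quantile of the standard normal distribution: as
  \<open>q\<close> tends to 0, its square is \<open>2 ln (1/q)\<close> up to lower order.
\<close>

lemma upper_quantile_bounds:
  assumes q: "1 - Phi c = q" "0 < q" "q < 1 / 2"
  shows "0 \<le> c" "c \<le> sqrt (2 * (- ln q))"
    and "sqrt (2 * (- ln q - ln (sqrt (2 * pi)))) - 1 \<le> c"
proof -
  show c: "0 \<le> c"
  proof (rule ccontr)
    assume "\<not> 0 \<le> c"
    then show False using Phi_gt_half[of "- c"] Phi_minus[of c] q by simp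
  qed
  have "ln q \<le> ln (exp (- c\<^sup>2 / 2))"
    using Phi_upper_tail_le[OF c] q by (subst ln_le_cancel_iff) auto
  then have "c\<^sup>2 \<le> 2 * (- ln q)" by simp
  then show "c \<le> sqrt (2 * (- ln q))" by (rule real_le_rsqrt)
  have "ln (std_normal_density (c + 1)) \<le> ln q"
    using Phi_upper_tail_ge[OF c] q by (subst ln_le_cancel_iff) (auto simp: normal_density_pos)
  moreover have "ln (std_normal_density (c + 1)) = - (c + 1)\<^sup>2 / 2 - ln (sqrt (2 * pi))"
    by (simp add: normal_density_def ln_mult ln_div)
  ultimately have "2 * (- ln q - ln (sqrt (2 * pi))) \<le> (c + 1)\<^sup>2" by simp
  then have "sqrt (2 * (- ln q - ln (sqrt (2 * pi)))) \<le> c + 1"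
    using c by (intro real_le_lsqrt) auto
  then show "sqrt (2 * (- ln q - ln (sqrt (2 * pi)))) - 1 \<le> c" by simp
qed


section \<open>The Bayes risk of a fixed threshold\<close>

text \<open>
  The Bayes risk of a threshold \<open>c\<close> on the standardised observations, in units of the expected
  cost \<open>m p \<delta>\<^sub>A\<close> of accepting every hypothesis; \<open>k\<close> stands for \<open>f \<delta>\<close>.
  The factor 2 and the shape of the second term express two-sided probabilities, so the formula is
  a risk only for \<open>c \<ge> 0\<close>.
\<close>

definition threshold_risk :: "real \<Rightarrow> real \<Rightarrow> real \<Rightarrow> real" where
  "threshold_risk k u c = k * (2 * (1 - Phi c)) + (2 * Phi (c / sqrt (1 + u)) - 1)"

text \<open>
  The region \<open>B\<close> may contain any part of the boundary: the Bonferroni rule rejects strictly above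
  its threshold, the oracle from its threshold on.
\<close>

lemma (in two_groups_model) bayes_risk_threshold:
  assumes deltaA: "0 < deltaA" and c: "0 \<le> c" and B: "B \<in> sets borel"
    and D: "\<And>x i. D x i \<longleftrightarrow> x i \<in> B"
    and inner: "\<And>x. c < \<bar>x\<bar> / sqrt sigma2 \<Longrightarrow> x \<in> B"
    and outer: "\<And>x. x \<in> B \<Longrightarrow> c \<le> \<bar>x\<bar> / sqrt sigma2"
  shows "bayes_risk M m nu X delta0 deltaA D =
    real m * p * deltaA * threshold_risk ((1 - p) / p * (delta0 / deltaA)) (tau2 / sigma2) c"
proof -
  have in': "c * sqrt sigma2 < \<bar>x\<bar> \<Longrightarrow> x \<in> B" and out': "x \<in> B \<Longrightarrow> c * sqrt sigma2 \<le> \<bar>x\<bar>" for x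
    using inner[of x] outer[of x] sigma2_pos by (auto simp: field_simps)
  have st: "0 < sigma2 + tau2" using sigma2_pos tau2_pos by simp
  have cs: "0 \<le> c * sqrt sigma2" using c sigma2_pos by simp
  have null: "measure (normal_law sigma2) B = 2 * (1 - Phi c)"
    using measure_normal_two_sided[OF _ cs B in' out', of "sqrt sigma2"] sigma2_pos by simp
  have "sigma2 + tau2 = sigma2 * (1 + tau2 / sigma2)"
    using sigma2_pos by (simp add: field_simps)
  then have "sqrt (sigma2 + tau2) = sqrt sigma2 * sqrt (1 + tau2 / sigma2)"
    by (metis real_sqrt_mult)
  then have ratio: "c * sqrt sigma2 / sqrt (sigma2 + tau2) = c / sqrt (1 + tau2 / sigma2)"
    using sigma2_pos by simp
  have "measure (normal_law (sigma2 + tau2)) B = 2 * (1 - Phi (c / sqrt (1 + tau2 / sigma2)))"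
    using measure_normal_two_sided[OF _ cs B in' out', of "sqrt (sigma2 + tau2)"] st ratio by simp
  moreover have "measure (normal_law (sigma2 + tau2)) (- B) = 1 - measure (normal_law (sigma2 + tau2)) B"
    using prob_space.prob_compl[OF prob_space_normal_density, of "sqrt (sigma2 + tau2)" B 0] st B
    by (simp add: Compl_eq_Diff_UNIV)
  ultimately have alt: "measure (normal_law (sigma2 + tau2)) (- B)
      = 2 * Phi (c / sqrt (1 + tau2 / sigma2)) - 1" by simp
  have nB: "- B \<in> sets borel" using B by auto
  have "bayes_risk M m nu X delta0 deltaA D =
    (\<Sum>i\<in>{1..m}. delta0 * \<P>(\<omega> in M. \<not> nu i \<omega> \<and> D (observed m X \<omega>) i)
              + deltaA * \<P>(\<omega> in M. nu i \<omega> \<and> \<not> D (observed m X \<omega>) i))"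
    using B by (intro bayes_risk_eq_sum) (simp add: D, measurable)
  also have "\<dots> = (\<Sum>i\<in>{1..m}. delta0 * ((1 - p) * (2 * (1 - Phi c)))
              + deltaA * (p * (2 * Phi (c / sqrt (1 + tau2 / sigma2)) - 1)))"
  proof (rule sum.cong[OF refl])
    fix i assume i: "i \<in> {1..m}"
    then show "delta0 * \<P>(\<omega> in M. \<not> nu i \<omega> \<and> D (observed m X \<omega>) i)
              + deltaA * \<P>(\<omega> in M. nu i \<omega> \<and> \<not> D (observed m X \<omega>) i)
      = delta0 * ((1 - p) * (2 * (1 - Phi c)))
              + deltaA * (p * (2 * Phi (c / sqrt (1 + tau2 / sigma2)) - 1))"
      using joint_null[OF i B] joint_alternative[OF i nB] null alt by (simp add: D observed_def)
  qed
  also have "\<dots> = real m * p * deltaA * threshold_risk ((1 - p) / p * (delta0 / deltaA)) (tau2 / sigma2) c"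
    using p_pos deltaA by (simp add: threshold_risk_def field_simps)
  finally show ?thesis .
qed

lemma threshold_risk_tendsto:
  assumes "(\<lambda>m. k m * (2 * (1 - Phi (c m)))) \<longlonglongrightarrow> 0"
    and "(\<lambda>m. c m / sqrt (1 + u m)) \<longlonglongrightarrow> a"
  shows "(\<lambda>m. threshold_risk (k m) (u m) (c m)) \<longlonglongrightarrow> 2 * Phi a - 1"
proof -
  have "(\<lambda>m. Phi (c m / sqrt (1 + u m))) \<longlonglongrightarrow> Phi a"
    using isCont_tendsto_compose[OF isCont_Phi assms(2)] .
  then have "(\<lambda>m. k m * (2 * (1 - Phi (c m))) + (2 * Phi (c m / sqrt (1 + u m)) - 1))
      \<longlonglongrightarrow> 0 + (2 * Phi a - 1)"
    by (intro tendsto_add tendsto_diff tendsto_mult tendsto_const assms(1))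
  then show ?thesis by (simp add: threshold_risk_def)
qed

section \<open>Asymptotics of the two thresholds\<close>

text \<open>
  The oracle threshold satisfies \<open>c\<^sup>2 \<ge> ln v\<close>, so the Gaussian tail at \<open>c\<close> is at most
  \<open>1 / sqrt v\<close>; as \<open>k = sqrt (v / u)\<close>, the false rejections cost at most \<open>2 / sqrt u\<close>.
\<close>

lemma oracle_threshold_asymp:
  fixes u k v :: "nat \<Rightarrow> real"
  assumes k_pos: "\<And>m. m \<ge> 1 \<Longrightarrow> 0 < k m"
    and u_pos: "\<And>m. m \<ge> 1 \<Longrightarrow> 0 < u m"
    and v_eq: "\<And>m. m \<ge> 1 \<Longrightarrow> v m = u m * (k m)\<^sup>2"
    and u_lim: "filterlim u at_top sequentially"
    and v_lim: "filterlim v at_top sequentially"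
    and C_lim: "(\<lambda>m. ln (v m) / u m) \<longlonglongrightarrow> C"
  defines "c \<equiv> \<lambda>m. sqrt ((1 + 1 / u m) * (ln (v m) + ln (1 + 1 / u m)))"
  shows "(\<lambda>m. k m * (2 * (1 - Phi (c m)))) \<longlonglongrightarrow> 0"
    and "(\<lambda>m. c m / sqrt (1 + u m)) \<longlonglongrightarrow> sqrt C"
proof -
  have ev1: "eventually (\<lambda>m::nat. m \<ge> 1) sequentially" by (rule eventually_ge_at_top)
  have evv: "eventually (\<lambda>m. v m > 1) sequentially"
    using v_lim by (simp add: filterlim_at_top_dense)
  have inv_u: "(\<lambda>m. 1 / u m) \<longlonglongrightarrow> 0"
    by (rule tendsto_divide_0[OF tendsto_const filterlim_at_top_imp_at_infinity[OF u_lim]])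
  have inv_su: "(\<lambda>m. 2 / sqrt (u m)) \<longlonglongrightarrow> 0"
    by (rule tendsto_divide_0[OF tendsto_const filterlim_at_top_imp_at_infinity])
      (rule filterlim_compose[OF sqrt_at_top u_lim])
  show "(\<lambda>m. k m * (2 * (1 - Phi (c m)))) \<longlonglongrightarrow> 0"
  proof (rule tendsto_sandwich[OF _ _ tendsto_const inv_su])
    show "eventually (\<lambda>m. 0 \<le> k m * (2 * (1 - Phi (c m)))) sequentially"
      using ev1 by eventually_elim (simp add: Phi_le_1 k_pos less_imp_le)
    show "eventually (\<lambda>m. k m * (2 * (1 - Phi (c m))) \<le> 2 / sqrt (u m)) sequentially"
      using ev1 evv
    proof eventually_elim
      case (elim m)
      have u: "0 < u m" and k: "0 < k m" using elim u_pos k_pos by auto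
      have lnv: "0 < ln (v m)" using elim by simp
      have lnu: "0 \<le> ln (1 + 1 / u m)" using u by simp
      have "1 * ln (v m) \<le> (1 + 1 / u m) * (ln (v m) + ln (1 + 1 / u m))"
        using u lnv lnu by (intro mult_mono) auto
      then have csq: "ln (v m) \<le> (c m)\<^sup>2" and c0: "0 \<le> c m"
        using lnv by (simp_all add: c_def)
      have sv: "sqrt (v m) = sqrt (u m) * k m"
        using v_eq[of m] elim k by (simp add: real_sqrt_mult)
      have "1 - Phi (c m) \<le> exp (- (c m)\<^sup>2 / 2)" by (rule Phi_upper_tail_le[OF c0])
      also have "\<dots> \<le> exp (- ln (sqrt (v m)))"
        using csq elim by (simp add: ln_sqrt)
      also have "\<dots> = 1 / (sqrt (u m) * k m)"
        using elim sv u k by (simp add: exp_minus inverse_eq_divide)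
      finally have "k m * (2 * (1 - Phi (c m))) \<le> k m * (2 * (1 / (sqrt (u m) * k m)))"
        using k by (intro mult_left_mono) auto
      then show ?case using k u by simp
    qed
  qed
  have "(\<lambda>m. ln (v m) / u m + ln (1 + 1 / u m) * (1 / u m)) \<longlonglongrightarrow> C + ln (1 + 0) * 0"
    by (intro tendsto_add tendsto_mult tendsto_ln tendsto_const C_lim inv_u) simp
  then have "(\<lambda>m. sqrt (ln (v m) / u m + ln (1 + 1 / u m) * (1 / u m))) \<longlonglongrightarrow> sqrt C"
    using tendsto_real_sqrt by fastforce
  moreover have "eventually (\<lambda>m. sqrt (ln (v m) / u m + ln (1 + 1 / u m) * (1 / u m))
      = c m / sqrt (1 + u m)) sequentially"
    using ev1
  proof eventually_elim
    case (elim m)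
    have u: "0 < u m" using elim u_pos by auto
    then have "1 + u m = u m * (1 + 1 / u m)" "1 + 1 / u m \<noteq> 0"
      using add_pos_pos[of 1 "1 / u m"] by (auto simp: field_simps)
    then have "ln (v m) / u m + ln (1 + 1 / u m) * (1 / u m)
        = (1 + 1 / u m) * (ln (v m) + ln (1 + 1 / u m)) / (1 + u m)"
      using u by (simp add: add_divide_distrib)
    then show ?case by (simp add: c_def real_sqrt_divide)
  qed
  ultimately show "(\<lambda>m. c m / sqrt (1 + u m)) \<longlonglongrightarrow> sqrt C"
    by (rule Lim_transform_eventually)
qed

text \<open>
  A threshold with \<open>- ln (1 - Phi c)\<close> asymptotic to \<open>L\<close> has \<open>c\<^sup>2 \<sim> 2 L\<close>, so \<open>c\<^sup>2 / (1 + u)\<close> tends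
  to \<open>C\<close> when \<open>L / u\<close> tends to \<open>C / 2\<close>.
\<close>

lemma upper_quantile_asymp:
  fixes c q L u :: "nat \<Rightarrow> real"
  assumes q: "\<And>m. m \<ge> 1 \<Longrightarrow> 1 - Phi (c m) = q m"
    and q_range: "\<And>m. m \<ge> 1 \<Longrightarrow> 0 < q m \<and> q m < 1 / 2"
    and L_lim: "filterlim L at_top sequentially"
    and u_lim: "filterlim u at_top sequentially"
    and q_lim: "(\<lambda>m. - ln (q m) / L m) \<longlonglongrightarrow> 1"
    and Lu_lim: "(\<lambda>m. L m / u m) \<longlonglongrightarrow> C / 2"
  shows "(\<lambda>m. c m / sqrt (1 + u m)) \<longlonglongrightarrow> sqrt C"
proof -
  define K where "K = ln (sqrt (2 * pi))"
  have ev1: "eventually (\<lambda>m::nat. m \<ge> 1) sequentially" by (rule eventually_ge_at_top)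
  have evL: "eventually (\<lambda>m. L m > 0) sequentially"
    using L_lim by (simp add: filterlim_at_top_dense)
  have evu: "eventually (\<lambda>m. u m > 0) sequentially"
    using u_lim by (simp add: filterlim_at_top_dense)
  have u1: "filterlim (\<lambda>m. 1 + u m) at_top sequentially"
    by (rule filterlim_tendsto_add_at_top[OF tendsto_const u_lim])
  have inv_u: "(\<lambda>m. x / (1 + u m)) \<longlonglongrightarrow> 0" for x
    by (rule tendsto_divide_0[OF tendsto_const filterlim_at_top_imp_at_infinity[OF u1]])
  have inv_su: "(\<lambda>m. 1 / sqrt (1 + u m)) \<longlonglongrightarrow> 0"
    by (rule tendsto_divide_0[OF tendsto_const filterlim_at_top_imp_at_infinity])
      (rule filterlim_compose[OF sqrt_at_top u1])
  have "(\<lambda>m. 2 * (- ln (q m) / L m * (L m / u m) * (1 - 1 / (1 + u m)))) \<longlonglongrightarrow> 2 * (1 * (C / 2) * (1 - 0))"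
    by (intro tendsto_mult tendsto_diff tendsto_const q_lim Lu_lim inv_u)
  moreover have "eventually (\<lambda>m. 2 * (- ln (q m) / L m * (L m / u m) * (1 - 1 / (1 + u m)))
      = 2 * (- ln (q m)) / (1 + u m)) sequentially"
    using evL evu
  proof eventually_elim
    case (elim m)
    have "1 - 1 / (1 + u m) = u m / (1 + u m)" using elim by (simp add: field_simps)
    then show ?case using elim by simp
  qed
  ultimately have "(\<lambda>m. 2 * (- ln (q m)) / (1 + u m)) \<longlonglongrightarrow> 2 * (1 * (C / 2) * (1 - 0))"
    by (rule Lim_transform_eventually)
  then have y_lim: "(\<lambda>m. 2 * (- ln (q m)) / (1 + u m)) \<longlonglongrightarrow> C" by simp
  then have upper: "(\<lambda>m. sqrt (2 * (- ln (q m)) / (1 + u m))) \<longlonglongrightarrow> sqrt C"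
    by (rule tendsto_real_sqrt)
  have "(\<lambda>m. sqrt (2 * (- ln (q m)) / (1 + u m) - 2 * K / (1 + u m)) - 1 / sqrt (1 + u m))
      \<longlonglongrightarrow> sqrt (C - 0) - 0"
    by (intro tendsto_diff tendsto_real_sqrt y_lim inv_u inv_su)
  then have lower: "(\<lambda>m. sqrt (2 * (- ln (q m)) / (1 + u m) - 2 * K / (1 + u m)) - 1 / sqrt (1 + u m))
      \<longlonglongrightarrow> sqrt C" by simp
  show ?thesis
  proof (rule tendsto_sandwich[OF _ _ lower upper])
    show "eventually (\<lambda>m. sqrt (2 * (- ln (q m)) / (1 + u m) - 2 * K / (1 + u m)) - 1 / sqrt (1 + u m)
        \<le> c m / sqrt (1 + u m)) sequentially"
      using ev1 evu
    proof eventually_elim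
      case (elim m)
      have "sqrt (2 * (- ln (q m)) / (1 + u m) - 2 * K / (1 + u m)) - 1 / sqrt (1 + u m)
          = (sqrt (2 * (- ln (q m) - K)) - 1) / sqrt (1 + u m)"
        by (simp only: diff_divide_distrib[symmetric] real_sqrt_divide right_diff_distrib)
      also have "\<dots> \<le> c m / sqrt (1 + u m)"
        using upper_quantile_bounds(3)[OF q] q_range elim
        by (intro divide_right_mono) (auto simp: K_def)
      finally show ?case .
    qed
    show "eventually (\<lambda>m. c m / sqrt (1 + u m) \<le> sqrt (2 * (- ln (q m)) / (1 + u m))) sequentially"
      using ev1 evu
    proof eventually_elim
      case (elim m)
      then show ?case
        using upper_quantile_bounds(2)[OF q] q_range
        by (simp only: real_sqrt_divide) (intro divide_right_mono, auto)
    qed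
  qed
qed

text \<open>
  Here \<open>L = ln (f / r)\<close>. Since \<open>ln (m p)\<close> is negligible against \<open>ln m\<close>, the sparsity satisfies
  \<open>- ln p \<ge> ln m / 2\<close> eventually, and \<open>L\<close> is at least \<open>- ln p\<close> up to a bounded term because
  \<open>\<alpha>\<close> stays away from 1. Hence \<open>ln m = O(L)\<close>, and \<open>ln (m p)\<close> is negligible against \<open>L\<close> as well.
\<close>

lemma ln_expected_alternatives_negligible:
  fixes p alpha L :: "nat \<Rightarrow> real"
  assumes p_range: "\<And>m. m \<ge> 1 \<Longrightarrow> 0 < p m \<and> p m < 1"
    and alpha_range: "\<And>m. m \<ge> 1 \<Longrightarrow> 0 < alpha m \<and> alpha m < 1"
    and p_lim: "p \<longlonglongrightarrow> 0" and alpha_lim: "alpha \<longlonglongrightarrow> a" and a: "a < 1"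
    and log_mp_lim: "(\<lambda>m. ln (real m * p m) / ln (real m)) \<longlonglongrightarrow> 0"
    and L_eq: "\<And>m. m \<ge> 1 \<Longrightarrow> L m = ln (1 - p m) - ln (p m) - ln (alpha m) + ln (1 - alpha m)"
    and L_lim: "filterlim L at_top sequentially"
  shows "(\<lambda>m. ln (real m * p m) / L m) \<longlonglongrightarrow> 0"
proof -
  have ev2: "eventually (\<lambda>m::nat. m \<ge> 2) sequentially" by (rule eventually_ge_at_top)
  have evL: "eventually (\<lambda>m. L m > 0) sequentially"
    using L_lim by (simp add: filterlim_at_top_dense)
  have "(\<lambda>m. ln (1 - p m) + ln (1 - alpha m)) \<longlonglongrightarrow> ln (1 - 0) + ln (1 - a)"
    using a by (intro tendsto_add tendsto_ln tendsto_diff tendsto_const p_lim alpha_lim) auto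
  from tendsto_divide_0[OF this filterlim_at_top_imp_at_infinity[OF L_lim]]
  have small: "(\<lambda>m. (ln (1 - p m) + ln (1 - alpha m)) / L m) \<longlonglongrightarrow> 0" .
  have ev_small: "eventually (\<lambda>m. (ln (1 - p m) + ln (1 - alpha m)) / L m > - 1) sequentially"
    using order_tendstoD(1)[OF small, of "- 1"] by simp
  have ev_half: "eventually (\<lambda>m. ln (real m * p m) / ln (real m) < 1 / 2) sequentially"
    using order_tendstoD(2)[OF log_mp_lim, of "1 / 2"] by simp
  have bound: "eventually (\<lambda>m. norm (ln (real m) / L m) \<le> 4) sequentially"
    using ev2 evL ev_small ev_half
  proof eventually_elim
    case (elim m)
    have m1: "m \<ge> 1" using elim by simp
    have r: "0 < p m" "p m < 1" "0 < alpha m" "alpha m < 1" "0 < real m"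
      using p_range[OF m1] alpha_range[OF m1] m1 by auto
    have lnm: "0 < ln (real m)" using elim by simp
    have "ln (real m * p m) < ln (real m) / 2" using elim lnm by (simp add: field_simps)
    then have "ln (real m) / 2 \<le> - ln (p m)" using r by (simp add: ln_mult)
    moreover have "ln (alpha m) \<le> 0" using r by simp
    ultimately have "ln (real m) / 2 \<le> L m - (ln (1 - p m) + ln (1 - alpha m))"
      using L_eq[OF m1] by linarith
    moreover have "- L m < ln (1 - p m) + ln (1 - alpha m)"
      using elim by (simp add: field_simps)
    ultimately have "ln (real m) \<le> 4 * L m" by linarith
    moreover have "0 < L m" by fact
    ultimately show ?case using lnm by (simp add: pos_divide_le_eq)
  qed
  have "(\<lambda>m. ln (real m * p m) / ln (real m) * (ln (real m) / L m)) \<longlonglongrightarrow> 0"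
  proof (rule tendsto_0_le[where K = 4])
    show "(\<lambda>m. ln (real m * p m) / ln (real m)) \<longlonglongrightarrow> 0" by fact
    show "eventually (\<lambda>m. norm (ln (real m * p m) / ln (real m) * (ln (real m) / L m))
        \<le> norm (ln (real m * p m) / ln (real m)) * 4) sequentially"
      using bound by eventually_elim (simp only: norm_mult mult_left_mono norm_ge_zero)
  qed
  then show ?thesis
    by (rule Lim_transform_eventually)
      (use ev2 in eventually_elim, simp)
qed

theorem lemma5p1:
  fixes M :: "nat \<Rightarrow> 'a measure"
    and nu :: "nat \<Rightarrow> nat \<Rightarrow> 'a \<Rightarrow> bool"
    and X :: "nat \<Rightarrow> nat \<Rightarrow> 'a \<Rightarrow> real"
    and p sigma2 tau2 delta0 deltaA :: "nat \<Rightarrow> real"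
    and u f delta v alpha r s :: "nat \<Rightarrow> real"
    and C alpha_inf :: real and s_inf :: ereal
  assumes model: "\<And>m. m \<ge> 1 \<Longrightarrow> two_groups_model (M m) m (p m) (sigma2 m) (tau2 m) (nu m) (X m)"
    and delta0_pos: "\<And>m. m \<ge> 1 \<Longrightarrow> delta0 m > 0"
    and deltaA_pos: "\<And>m. m \<ge> 1 \<Longrightarrow> deltaA m > 0"
    and u_eq: "\<And>m. m \<ge> 1 \<Longrightarrow> u m = tau2 m / sigma2 m"
    and f_eq: "\<And>m. m \<ge> 1 \<Longrightarrow> f m = (1 - p m) / p m"
    and delta_eq: "\<And>m. m \<ge> 1 \<Longrightarrow> delta m = delta0 m / deltaA m"
    and v_eq: "\<And>m. m \<ge> 1 \<Longrightarrow> v m = u m * (f m)\<^sup>2 * (delta m)\<^sup>2"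
    and p_lim: "p \<longlonglongrightarrow> 0"
    and u_lim: "filterlim u at_top sequentially"
    and v_lim: "filterlim v at_top sequentially"
    and C_lim: "(\<lambda>m. ln (v m) / u m) \<longlonglongrightarrow> C" and C_pos: "0 < C"
    and mp_lim: "(\<lambda>m. ereal (real m * p m)) \<longlonglongrightarrow> s_inf" and s_inf_pos: "0 < s_inf"
    and log_mp_lim: "(\<lambda>m. ln (real m * p m) / ln (real m)) \<longlonglongrightarrow> 0"
    and alpha_range: "\<And>m. m \<ge> 1 \<Longrightarrow> 0 < alpha m \<and> alpha m < 1"
    and alpha_lim: "alpha \<longlonglongrightarrow> alpha_inf"
    and alpha_inf_range: "0 \<le> alpha_inf" "alpha_inf < 1"
    and r_eq: "\<And>m. m \<ge> 1 \<Longrightarrow> r m = alpha m / (1 - alpha m)"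
    and s_eq: "\<And>m. m \<ge> 1 \<Longrightarrow> ln (f m * delta m * sqrt (u m)) / ln (f m / r m) = 1 + s m"
    and s_lim: "s \<longlonglongrightarrow> 0"
    and s_log_lim: "filterlim (\<lambda>m. 2 * s m * ln (f m / r m) - ln (ln (f m / r m))) at_bot sequentially"
  shows "ABOS M nu X p sigma2 tau2 delta0 deltaA (\<lambda>m. bonferroni m (alpha m) (sigma2 m))"
proof -
  define k where "k m = f m * delta m" for m
  define L where "L m = ln (f m / r m)" for m
  have ev1: "eventually (\<lambda>m::nat. m \<ge> 1) sequentially" by (rule eventually_ge_at_top)
  have p: "0 < p m" "p m < 1" and sigma2: "0 < sigma2 m" and tau2: "0 < tau2 m" if "m \<ge> 1" for m
    using model[OF that] by (auto simp: two_groups_model_def two_groups_model_axioms_def)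
  have alpha: "0 < alpha m" "alpha m < 1" if "m \<ge> 1" for m using alpha_range[OF that] by auto
  have u_pos: "0 < u m" and f_pos: "0 < f m" and delta_pos: "0 < delta m" and r_pos: "0 < r m"
    if "m \<ge> 1" for m
    using that p sigma2 tau2 delta0_pos deltaA_pos alpha by (auto simp: u_eq f_eq delta_eq r_eq)
  have k_pos: "0 < k m" if "m \<ge> 1" for m using f_pos delta_pos that by (simp add: k_def)
  have v_k: "v m = u m * (k m)\<^sup>2" if "m \<ge> 1" for m
    using v_eq[OF that] by (simp add: k_def power_mult_distrib)
  have evv: "eventually (\<lambda>m. v m > 1) sequentially"
    using v_lim by (simp add: filterlim_at_top_dense)
  have s1: "(\<lambda>m. 1 + s m) \<longlonglongrightarrow> 1" using tendsto_add[OF tendsto_const s_lim, of 1] by simp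
  have evs: "eventually (\<lambda>m. 1 + s m > 0) sequentially"
    using order_tendstoD(1)[OF s1, of 0] by simp

  \<comment> \<open>Both \<open>v\<close> and \<open>f \<delta>\<close> are read off from \<open>L\<close>. Since \<open>x / 0 = 0\<close>, the relation defining
    \<open>s\<close> also excludes \<open>L = 0\<close> as soon as \<open>1 + s > 0\<close>.\<close>
  have ln_k: "eventually (\<lambda>m. ln (k m * sqrt (u m)) = (1 + s m) * L m \<and> ln (v m) = 2 * ((1 + s m) * L m)) sequentially"
    using ev1 evs
  proof eventually_elim
    case (elim m)
    have "ln (k m * sqrt (u m)) / L m = 1 + s m"
      using s_eq elim by (simp add: k_def L_def)
    moreover from this have "L m \<noteq> 0" using elim by auto
    ultimately have *: "ln (k m * sqrt (u m)) = (1 + s m) * L m" by (simp add: field_simps)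
    have "v m = (k m * sqrt (u m))\<^sup>2"
      using v_k u_pos elim by (simp add: power_mult_distrib less_imp_le)
    then have "ln (v m) = 2 * ln (k m * sqrt (u m))"
      using k_pos u_pos elim by (simp add: ln_realpow)
    with * show ?case by simp
  qed
  have half: "(\<lambda>m. 1 / (2 * (1 + s m))) \<longlonglongrightarrow> 1 / (2 * 1)"
    by (intro tendsto_divide tendsto_mult tendsto_const s1) simp
  have L_v: "eventually (\<lambda>m. 1 / (2 * (1 + s m)) * ln (v m) = L m) sequentially"
    using ln_k evs
  proof eventually_elim
    case (elim m)
    have "1 / (2 * d) * (2 * (d * l)) = l" if "0 < d" for d l :: real using that by simp
    from this[of "1 + s m" "L m"] show ?case using elim by simp
  qed
  have L_lim: "filterlim L at_top sequentially"
  proof -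
    have "filterlim (\<lambda>m. 1 / (2 * (1 + s m)) * ln (v m)) at_top sequentially"
      by (rule filterlim_tendsto_pos_mult_at_top[OF half]) (simp, rule filterlim_compose[OF ln_at_top v_lim])
    then show ?thesis using filterlim_cong[OF refl refl L_v] by simp
  qed
  have evL: "eventually (\<lambda>m. L m > 0) sequentially"
    using L_lim by (simp add: filterlim_at_top_dense)
  have Lu_lim: "(\<lambda>m. L m / u m) \<longlonglongrightarrow> C / 2"
  proof -
    have "(\<lambda>m. 1 / (2 * (1 + s m)) * (ln (v m) / u m)) \<longlonglongrightarrow> 1 / (2 * 1) * C"
      by (intro tendsto_mult half C_lim)
    moreover have "eventually (\<lambda>m. 1 / (2 * (1 + s m)) * (ln (v m) / u m) = L m / u m) sequentially"
      using L_v by eventually_elim simp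
    ultimately have "(\<lambda>m. L m / u m) \<longlonglongrightarrow> 1 / (2 * 1) * C" by (rule Lim_transform_eventually)
    then show ?thesis by simp
  qed
  have L_eq: "L m = ln (1 - p m) - ln (p m) - ln (alpha m) + ln (1 - alpha m)" if "m \<ge> 1" for m
  proof -
    have "L m = ln (f m) - ln (r m)" using f_pos[OF that] r_pos[OF that] by (simp add: L_def ln_div)
    then show ?thesis using p[OF that] alpha[OF that] that by (simp add: f_eq r_eq ln_div)
  qed

  define q where "q m = alpha m / (2 * real m)" for m
  define cB where "cB m = c_Bon m (alpha m)" for m
  have q_range: "0 < q m \<and> q m < 1 / 2" if "m \<ge> 1" for m
    using alpha[OF that] that by (auto simp: q_def field_simps)
  have cB: "1 - Phi (cB m) = q m" if "m \<ge> 1" for m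
    unfolding cB_def q_def c_Bon_def using c_Bon_ex1[OF that alpha[OF that]] by (rule theI')
  have cB_nonneg: "0 \<le> cB m" if "m \<ge> 1" for m
    using upper_quantile_bounds(1)[OF cB[OF that]] q_range[OF that] by simp

  have q_lim: "(\<lambda>m. - ln (q m) / L m) \<longlonglongrightarrow> 1"
  proof -
    have "(\<lambda>m. ln 2 - ln (1 - p m) - ln (1 - alpha m)) \<longlonglongrightarrow> ln 2 - ln (1 - 0) - ln (1 - alpha_inf)"
      using alpha_inf_range by (intro tendsto_diff tendsto_ln tendsto_const p_lim alpha_lim) auto
    from tendsto_divide_0[OF this filterlim_at_top_imp_at_infinity[OF L_lim]]
    have a: "(\<lambda>m. (ln 2 - ln (1 - p m) - ln (1 - alpha m)) / L m) \<longlonglongrightarrow> 0" .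
    have b: "(\<lambda>m. ln (real m * p m) / L m) \<longlonglongrightarrow> 0"
      by (rule ln_expected_alternatives_negligible[OF _ alpha_range p_lim alpha_lim alpha_inf_range(2) log_mp_lim L_eq L_lim])
        (auto intro: p)
    have "(\<lambda>m. 1 + (ln 2 - ln (1 - p m) - ln (1 - alpha m)) / L m + ln (real m * p m) / L m) \<longlonglongrightarrow> 1 + 0 + 0"
      by (intro tendsto_add tendsto_const a b)
    moreover have "eventually (\<lambda>m. 1 + (ln 2 - ln (1 - p m) - ln (1 - alpha m)) / L m + ln (real m * p m) / L m
        = - ln (q m) / L m) sequentially"
      using ev1 evL
    proof eventually_elim
      case (elim m)
      have "- ln (q m) = L m + (ln 2 - ln (1 - p m) - ln (1 - alpha m)) + ln (real m * p m)"
        using L_eq[of m] elim p[of m] alpha[of m] by (simp add: q_def ln_div ln_mult)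
      then show ?case using elim by (simp only: add_divide_distrib) simp
    qed
    ultimately have "(\<lambda>m. - ln (q m) / L m) \<longlonglongrightarrow> 1 + 0 + 0" by (rule Lim_transform_eventually)
    then show ?thesis by simp
  qed
  have cB_lim: "(\<lambda>m. cB m / sqrt (1 + u m)) \<longlonglongrightarrow> sqrt C"
    by (rule upper_quantile_asymp[OF cB q_range L_lim u_lim q_lim Lu_lim])

  have typeI_B: "(\<lambda>m. k m * (2 * (1 - Phi (cB m)))) \<longlonglongrightarrow> 0"
  proof -
    obtain e where e: "0 < e" "ereal e < s_inf"
      using ereal_dense2[OF s_inf_pos] by auto
    have eve: "eventually (\<lambda>m. e < real m * p m) sequentially"
      using order_tendstoD(1)[OF mp_lim e(2)] by simp
    \<comment> \<open>This is \<open>exp (s L) / sqrt u\<close>, written so that the limits of \<open>2 s L - ln L\<close> and of \<open>L / u\<close>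
      apply; by the definition of \<open>L\<close>, it equals \<open>f \<delta> / (f / r)\<close>.\<close>
    define g where "g m = exp ((2 * s m * L m - ln (L m)) / 2) * sqrt (L m / u m)" for m
    have "filterlim (\<lambda>m. 1 / 2 * (2 * s m * L m - ln (L m))) at_bot sequentially"
      using filterlim_tendsto_pos_mult_at_bot[OF tendsto_const _ s_log_lim, of "1 / 2"] by (simp add: L_def)
    then have "(\<lambda>m. exp ((2 * s m * L m - ln (L m)) / 2)) \<longlonglongrightarrow> 0"
      using filterlim_compose[OF exp_at_bot] by simp
    then have "g \<longlonglongrightarrow> 0 * sqrt (C / 2)"
      unfolding g_def by (intro tendsto_mult tendsto_real_sqrt Lu_lim)
    then have g_lim: "(\<lambda>m. g m / e) \<longlonglongrightarrow> 0"
      using e tendsto_divide[OF _ tendsto_const, of g 0 sequentially e] by simp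
    show ?thesis
    proof (rule tendsto_sandwich[OF _ _ tendsto_const g_lim])
      show "eventually (\<lambda>m. 0 \<le> k m * (2 * (1 - Phi (cB m)))) sequentially"
        using ev1 by eventually_elim (simp add: Phi_le_1 k_pos less_imp_le)
      show "eventually (\<lambda>m. k m * (2 * (1 - Phi (cB m))) \<le> g m / e) sequentially"
        using ev1 evL eve ln_k
      proof eventually_elim
        case (elim m)
        have m: "m \<ge> 1" by fact
        have "k m * sqrt (u m) = exp ((1 + s m) * L m)"
          using elim k_pos[OF m] u_pos[OF m] by (metis exp_ln mult_pos_pos real_sqrt_gt_zero)
        also have "\<dots> = exp (s m * L m) * (f m / r m)"
          using f_pos[OF m] r_pos[OF m] by (simp add: algebra_simps exp_add) (simp add: L_def)
        finally have k: "k m = exp (s m * L m) * (f m / r m) / sqrt (u m)"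
          using u_pos[OF m] by (subst nonzero_eq_divide_eq) auto
        have "exp ((2 * s m * L m - ln (L m)) / 2) * sqrt (L m) = exp (s m * L m)"
        proof -
          have "(2 * s m * L m - ln (L m)) / 2 = s m * L m - ln (sqrt (L m))"
            using elim by (simp add: ln_sqrt diff_divide_distrib)
          then have "exp ((2 * s m * L m - ln (L m)) / 2) = exp (s m * L m) / sqrt (L m)"
            using elim by (simp only: exp_diff) simp
          then show ?thesis using elim by simp
        qed
        then have g: "g m = exp (s m * L m) / sqrt (u m)"
          unfolding g_def by (simp add: real_sqrt_divide)
        have fr: "f m / r m * alpha m = (1 - p m) / p m * (1 - alpha m)"
          using alpha[OF m] by (simp add: f_eq[OF m] r_eq[OF m])
        have "2 * (1 - Phi (cB m)) = alpha m / real m"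
          using m by (simp add: cB[OF m] q_def)
        then have "k m * (2 * (1 - Phi (cB m))) = g m * (f m / r m * alpha m) / real m"
          unfolding k g by (simp add: mult_ac)
        also have "\<dots> = g m * ((1 - p m) * (1 - alpha m)) / (real m * p m)"
          unfolding fr by (simp add: mult.commute)
        also have "\<dots> \<le> g m * 1 / e"
        proof (rule frac_le)
          have "(1 - p m) * (1 - alpha m) \<le> 1 * 1"
            using p[OF m] alpha[OF m] by (intro mult_mono) auto
          then show "g m * ((1 - p m) * (1 - alpha m)) \<le> g m * 1"
            using u_pos[OF m] by (intro mult_left_mono) (auto simp: g)
          show "0 \<le> g m * 1" using u_pos[OF m] by (simp add: g)
        qed (use e elim in auto)
        finally show ?case by simp
      qed
    qed
  qed

  define cO where "cO m = sqrt ((1 + 1 / u m) * (ln (v m) + ln (1 + 1 / u m)))" for m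
  note oracle_lims = oracle_threshold_asymp[OF k_pos u_pos v_k u_lim v_lim C_lim, folded cO_def]
  have lim_pos: "0 < 2 * Phi (sqrt C) - 1" using Phi_gt_half[of "sqrt C"] C_pos by simp
  have "(\<lambda>m. threshold_risk (k m) (u m) (cB m) / threshold_risk (k m) (u m) (cO m))
      \<longlonglongrightarrow> (2 * Phi (sqrt C) - 1) / (2 * Phi (sqrt C) - 1)"
    using lim_pos by (intro tendsto_divide threshold_risk_tendsto typeI_B cB_lim oracle_lims) auto
  then have lim: "(\<lambda>m. threshold_risk (k m) (u m) (cB m) / threshold_risk (k m) (u m) (cO m)) \<longlonglongrightarrow> 1"
    using lim_pos by simp
  show ?thesis
    unfolding ABOS_def
  proof (rule Lim_transform_eventually[OF lim], use ev1 evv in eventually_elim)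
    case (elim m)
    have m: "m \<ge> 1" by fact
    have kk: "(1 - p m) / p m * (delta0 m / deltaA m) = k m"
      using m by (simp add: k_def f_eq delta_eq)
    have "bayes_risk (M m) m (nu m) (X m) (delta0 m) (deltaA m) (bonferroni m (alpha m) (sigma2 m))
      = real m * p m * deltaA m * threshold_risk ((1 - p m) / p m * (delta0 m / deltaA m)) (tau2 m / sigma2 m) (cB m)"
      by (rule two_groups_model.bayes_risk_threshold[OF model[OF m] deltaA_pos[OF m] cB_nonneg[OF m],
            where B = "{x. cB m < \<bar>x\<bar> / sqrt (sigma2 m)}"])
        (auto simp: bonferroni_def cB_def)
    then have B: "bayes_risk (M m) m (nu m) (X m) (delta0 m) (deltaA m) (bonferroni m (alpha m) (sigma2 m))
      = real m * p m * deltaA m * threshold_risk (k m) (u m) (cB m)"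
      by (simp only: kk u_eq[OF m])
    have cO: "0 \<le> cO m" unfolding cO_def using elim u_pos[OF m] by auto
    have sq: "cO m \<le> \<bar>x\<bar> / sqrt (sigma2 m) \<longleftrightarrow>
        x\<^sup>2 / sigma2 m \<ge> (1 + 1 / u m) * (ln (v m) + ln (1 + 1 / u m))" for x
    proof -
      have "\<bar>x\<bar> / sqrt (sigma2 m) = sqrt (x\<^sup>2 / sigma2 m)" by (simp add: real_sqrt_divide)
      then show ?thesis unfolding cO_def by simp
    qed
    have "bayes_risk (M m) m (nu m) (X m) (delta0 m) (deltaA m)
        (bayes_oracle (p m) (sigma2 m) (tau2 m) (delta0 m) (deltaA m))
      = real m * p m * deltaA m * threshold_risk ((1 - p m) / p m * (delta0 m / deltaA m)) (tau2 m / sigma2 m) (cO m)"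
    proof (rule two_groups_model.bayes_risk_threshold[OF model[OF m] deltaA_pos[OF m] cO,
            where B = "{x. cO m \<le> \<bar>x\<bar> / sqrt (sigma2 m)}"])
      show "bayes_oracle (p m) (sigma2 m) (tau2 m) (delta0 m) (deltaA m) x i
          \<longleftrightarrow> x i \<in> {x. cO m \<le> \<bar>x\<bar> / sqrt (sigma2 m)}" for x i
        using sq m by (simp add: bayes_oracle_def Let_def u_eq f_eq delta_eq v_eq)
    qed auto
    then have O: "bayes_risk (M m) m (nu m) (X m) (delta0 m) (deltaA m)
        (bayes_oracle (p m) (sigma2 m) (tau2 m) (delta0 m) (deltaA m))
      = real m * p m * deltaA m * threshold_risk (k m) (u m) (cO m)"
      by (simp only: kk u_eq[OF m])
    show ?case
      unfolding B O using p[OF m] deltaA_pos[OF m] m by simp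
  qed
qed

end
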